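(* Let $X$ and $Y$ be locally convex Hausdorff topological vector spaces and let $F\colon X\rightrightarrows Y$ be a polyhedral convex multifunction. If $D\subset Y$ is a generalized polyhedral convex set, then $F^{-1}(D)$ is a polyhedral convex set in $X$. In particular, if $Q\subset Y$ is a polyhedral convex set, then $F^{-1}(Q)$ is a polyhedral convex set in $X$.
   Context: All vector spaces are real. A subset $D$ of a locally convex Hausdorff topological vector space $E$ is a generalized polyhedral convex set if there exist finitely many continuous linear functionals $e_i^*\in E^*$, $\alpha_i\in\mathbb{R}$, $i=1,\dots,m$, and a closed affine subspace $L\subset E$ such that $D=\{e\in E\mid e\in L,\ \langle e_i^*,e\rangle\le\alpha_i,\ i=1,\dots,m\}$; it is a polyhedral convex set if such a representation exists with $L=E$. The empty set counts as polyhedral convex. A multifunction $F\colon X\rightrightarrows Y$ assigns to each $x\in X$ a (possibly empty) subset $F(x)\subset Y$; $\mathrm{gph}\,F=\{(x,y)\in X\times Y\mid y\in F(x)\}$. $F$ is polyhedral convex if $\mathrm{gph}\,F$ is a polyhedral convex set in $X\times Y$. The inverse $F^{-1}\colon Y\rightrightarrows X$ is $F^{-1}(y)=\{x\in X\mid y\in F(x)\}$, and $F^{-1}(D)=\bigcup_{y\in D}F^{-1}(y)=\{x\in X\mid F(x)\cap D\neq\emptyset\}$ for $D\subset Y$. *)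

theory Defs
  imports "HOL-Analysis.Analysis"
begin

text \<open>The topological classes of the library stop short of topological vector spaces without a norm.\<close>

class topological_real_vector = topological_ab_group_add + real_vector +
  assumes tendsto_scaleR_Pair:
    "LIM x (nhds r \<times>\<^sub>F nhds a). fst x *\<^sub>R snd x :> nhds (r *\<^sub>R a)"

text \<open>The constant \<^const>\<open>convex\<close> is not available inside a class specification,
  so its definition is written out in the local convexity axiom.\<close>

class locally_convex_hausdorff = topological_real_vector + t2_space +
  assumes convex_nhds_base_raw:
    "open U \<Longrightarrow> 0 \<in> U \<Longrightarrow>
      \<exists>V. open V \<and>
        (\<forall>x\<in>V. \<forall>y\<in>V. \<forall>u\<ge>0. \<forall>v\<ge>0. u + v = 1 \<longrightarrow> u *\<^sub>R x + v *\<^sub>R y \<in> V) \<and>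
        0 \<in> V \<and> V \<subseteq> U"

lemma convex_nhds_base:
  fixes U :: "'a::locally_convex_hausdorff set"
  shows "open U \<Longrightarrow> 0 \<in> U \<Longrightarrow> \<exists>V. open V \<and> convex V \<and> 0 \<in> V \<and> V \<subseteq> U"
  unfolding convex_def by (rule convex_nhds_base_raw)

instance real_normed_vector \<subseteq> topological_real_vector
proof
  fix r :: real and a :: 'a
  show "LIM x (nhds r \<times>\<^sub>F nhds a). fst x *\<^sub>R snd x :> nhds (r *\<^sub>R a)"
    unfolding nhds_prod[symmetric] by (intro tendsto_intros filterlim_fst filterlim_snd)
      (auto simp: nhds_prod filterlim_fst filterlim_snd)
qed

instance real_normed_vector \<subseteq> locally_convex_hausdorff
proof
  fix U :: "'a set"
  assume "open U" "0 \<in> U"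
  then obtain e where "e > 0" "ball 0 e \<subseteq> U"
    using open_contains_ball by blast
  then show "\<exists>V. open V \<and>
        (\<forall>x\<in>V. \<forall>y\<in>V. \<forall>u\<ge>0. \<forall>v\<ge>0. u + v = 1 \<longrightarrow> u *\<^sub>R x + v *\<^sub>R y \<in> V) \<and>
        0 \<in> V \<and> V \<subseteq> U"
    unfolding convex_def[symmetric]
    by (intro exI[of _ "ball 0 e"]) auto
qed

instance prod :: (topological_monoid_add, topological_monoid_add) topological_monoid_add
proof
  fix a b :: "'a \<times> 'b"
  have f: "((\<lambda>x. fst x) \<longlongrightarrow> a) (nhds a \<times>\<^sub>F nhds b)" "((\<lambda>x. snd x) \<longlongrightarrow> b) (nhds a \<times>\<^sub>F nhds b)"
    by (auto intro: filterlim_fst filterlim_snd)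
  have "((\<lambda>x. (fst (fst x) + fst (snd x), snd (fst x) + snd (snd x)))
      \<longlongrightarrow> (fst a + fst b, snd a + snd b)) (nhds a \<times>\<^sub>F nhds b)"
    using f by (intro tendsto_intros)
  then show "LIM x (nhds a \<times>\<^sub>F nhds b). fst x + snd x :> nhds (a + b)"
    by (simp add: plus_prod_def)
qed

instance prod :: (topological_comm_monoid_add, topological_comm_monoid_add) topological_comm_monoid_add ..

instance prod :: (topological_group_add, topological_group_add) topological_group_add
proof
  fix a :: "'a \<times> 'b"
  have "((\<lambda>x. (- fst x, - snd x)) \<longlongrightarrow> (- fst a, - snd a)) (nhds a)"
    by (intro tendsto_intros) (auto intro: filterlim_ident)
  moreover have "uminus = (\<lambda>x :: 'a \<times> 'b. (- fst x, - snd x))"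
    by (simp add: fun_eq_iff uminus_prod_def)
  ultimately show "(uminus \<longlongrightarrow> - a) (nhds a)"
    by (simp add: uminus_prod_def[of a])
qed

instance prod :: (topological_ab_group_add, topological_ab_group_add) topological_ab_group_add ..

instance prod :: (topological_real_vector, topological_real_vector) topological_real_vector
proof
  fix r :: real and a :: "'a \<times> 'b"
  have f: "((\<lambda>x. fst x) \<longlongrightarrow> r) (nhds r \<times>\<^sub>F nhds a)" "((\<lambda>x. snd x) \<longlongrightarrow> a) (nhds r \<times>\<^sub>F nhds a)"
    by (auto intro: filterlim_fst filterlim_snd)
  have 1: "((\<lambda>x. fst x *\<^sub>R fst (snd x)) \<longlongrightarrow> r *\<^sub>R fst a) (nhds r \<times>\<^sub>F nhds a)"
    using filterlim_compose[OF tendsto_scaleR_Pair filterlim_Pair[OF f(1) tendsto_fst[OF f(2)]]]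
    by simp
  have 2: "((\<lambda>x. fst x *\<^sub>R snd (snd x)) \<longlongrightarrow> r *\<^sub>R snd a) (nhds r \<times>\<^sub>F nhds a)"
    using filterlim_compose[OF tendsto_scaleR_Pair filterlim_Pair[OF f(1) tendsto_snd[OF f(2)]]]
    by simp
  show "LIM x (nhds r \<times>\<^sub>F nhds a). fst x *\<^sub>R snd x :> nhds (r *\<^sub>R a)"
    using tendsto_Pair[OF 1 2] by (simp add: scaleR_prod_def)
qed

instance prod :: (locally_convex_hausdorff, locally_convex_hausdorff) locally_convex_hausdorff
proof
  fix U :: "('a \<times> 'b) set"
  assume "open U" "0 \<in> U"
  then obtain A B where AB: "open A" "open B" "0 \<in> A \<times> B" "A \<times> B \<subseteq> U"
    by (rule open_prod_elim)
  obtain V where V: "open V" "convex V" "0 \<in> V" "V \<subseteq> A"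
    using convex_nhds_base[of A] AB by (auto simp: zero_prod_def)
  obtain W where W: "open W" "convex W" "0 \<in> W" "W \<subseteq> B"
    using convex_nhds_base[of B] AB by (auto simp: zero_prod_def)
  show "\<exists>V. open V \<and>
        (\<forall>x\<in>V. \<forall>y\<in>V. \<forall>u\<ge>0. \<forall>v\<ge>0. u + v = 1 \<longrightarrow> u *\<^sub>R x + v *\<^sub>R y \<in> V) \<and>
        0 \<in> V \<and> V \<subseteq> U"
    unfolding convex_def[symmetric]
    using V W AB(4)
    by (intro exI[of _ "V \<times> W"]) (auto simp: zero_prod_def open_Times convex_Times)
qed

definition topological_dual :: "('e::locally_convex_hausdorff \<Rightarrow> real) set" where
  "topological_dual = {f. linear f \<and> continuous_on UNIV f}"

text \<open>The library predicate \<^const>\<open>affine\<close> admits the empty set; this adds no new sets below,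
  because the empty set is polyhedral convex in any case (one inequality \<open>0 \<le> -1\<close>).\<close>

definition generalized_polyhedral_convex :: "'e::locally_convex_hausdorff set \<Rightarrow> bool" where
  "generalized_polyhedral_convex D \<longleftrightarrow>
    (\<exists>(m::nat) (f :: nat \<Rightarrow> 'e \<Rightarrow> real) (\<alpha> :: nat \<Rightarrow> real) L.
       (\<forall>i\<in>{1..m}. f i \<in> topological_dual) \<and> affine L \<and> closed L \<and>
       D = {x. x \<in> L \<and> (\<forall>i\<in>{1..m}. f i x \<le> \<alpha> i)})"

definition polyhedral_convex :: "'e::locally_convex_hausdorff set \<Rightarrow> bool" where
  "polyhedral_convex D \<longleftrightarrow>
    (\<exists>(m::nat) (f :: nat \<Rightarrow> 'e \<Rightarrow> real) (\<alpha> :: nat \<Rightarrow> real).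
       (\<forall>i\<in>{1..m}. f i \<in> topological_dual) \<and>
       D = {x. \<forall>i\<in>{1..m}. f i x \<le> \<alpha> i})"

lemma polyhedral_convex_empty: "polyhedral_convex {}"
  unfolding polyhedral_convex_def topological_dual_def
  by (intro exI[of _ 1] exI[of _ "\<lambda>_ _. 0"] exI[of _ "\<lambda>_. -1"])
     (auto simp: linear_iff)

lemma polyhedral_convex_imp_generalized:
  assumes "polyhedral_convex D"
  shows "generalized_polyhedral_convex D"
proof -
  obtain m :: nat and f \<alpha> where "\<forall>i\<in>{1..m}. f i \<in> topological_dual"
      and "D = {x. \<forall>i\<in>{1..m}. f i x \<le> \<alpha> i}"
    using assms unfolding polyhedral_convex_def by blast
  then show ?thesis
    unfolding generalized_polyhedral_convex_def
    by (intro exI[of _ m] exI[of _ f] exI[of _ \<alpha>] exI[of _ UNIV]) simp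
qed

text \<open>A multifunction from \<open>X\<close> to \<open>Y\<close> is a function \<open>X \<Rightarrow> Y set\<close>, with the empty set allowed as a value.\<close>

definition gph :: "('x \<Rightarrow> 'y set) \<Rightarrow> ('x \<times> 'y) set" where
  "gph F = {(x, y). y \<in> F x}"

definition polyhedral_convex_multifunction ::
    "('x::locally_convex_hausdorff \<Rightarrow> 'y::locally_convex_hausdorff set) \<Rightarrow> bool" where
  "polyhedral_convex_multifunction F \<longleftrightarrow> polyhedral_convex (gph F)"

definition multi_inverse :: "('x \<Rightarrow> 'y set) \<Rightarrow> 'y \<Rightarrow> 'x set" where
  "multi_inverse F y = {x. y \<in> F x}"

definition multi_inverse_image :: "('x \<Rightarrow> 'y set) \<Rightarrow> 'y set \<Rightarrow> 'x set" where
  "multi_inverse_image F D = (\<Union>y\<in>D. multi_inverse F y)"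

lemma multi_inverse_image_eq: "multi_inverse_image F D = {x. F x \<inter> D \<noteq> {}}"
  unfolding multi_inverse_image_def multi_inverse_def by auto

end

theory Submission
  imports Defs
begin

text \<open>
  Writing the inequalities of the graph as \<open>a x + b y \<le> \<gamma>\<close> and \<open>D\<close> as the set of
  \<open>y \<in> L\<close> that satisfy finitely many inequalities \<open>g y \<le> \<beta>\<close>, the inverse image of \<open>D\<close>
  consists of the \<open>x\<close> for which some \<open>y \<in> L\<close> solves a finite system of linear inequalities.
  After a translation that moves a point of \<open>L\<close> to the origin, \<open>L\<close> is a subspace \<open>V\<close>, and
  the task is to eliminate the variable \<open>y \<in> V\<close> from the system.

  Although \<open>V\<close> may have infinite dimension, only the finitely many functionals \<open>b\<close> see \<open>y\<close>,
  so Fourier-Motzkin elimination stops after finitely many steps. One step splits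
  \<open>y = w + s v\<close>, with \<open>v \<in> V\<close> chosen so that \<open>e v \<noteq> 0\<close> for one functional \<open>e\<close>
  and with \<open>w\<close> in \<open>V \<inter> ker e\<close>, and eliminates the scalar \<open>s\<close>
  (\<open>one_variable_elimination\<close>). The functionals of the new system are linear combinations of
  the old ones, hence on \<open>V \<inter> ker e\<close> they vanish wherever all functionals other than \<open>e\<close> do. Once all
  functionals are used up, the \<open>y\<close>-part of every inequality is zero on what is left of \<open>V\<close>,
  and a finite system in \<open>x\<close> alone remains (\<open>polyhedral_convex_projection\<close>). Its left hand
  sides are combinations of the continuous functionals \<open>a\<close>, so it describes a polyhedral
  convex set.
\<close>

section \<open>Finite systems of inequalities\<close>

lemma polyhedral_convex_finite_system:
  assumes "finite C" and "\<And>c. c \<in> C \<Longrightarrow> a c \<in> topological_dual"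
  shows "polyhedral_convex {x. \<forall>c\<in>C. a c x \<le> \<gamma> c}"
proof -
  obtain h where h: "bij_betw h {1..card C} C"
    using ex_bij_betw_nat_finite_1[OF assms(1)] by blast
  then have img: "h ` {1..card C} = C"
    by (simp add: bij_betw_def)
  have "{x. \<forall>c\<in>C. a c x \<le> \<gamma> c} = {x. \<forall>i\<in>{1..card C}. a (h i) x \<le> \<gamma> (h i)}"
    by (subst img[symmetric]) auto
  moreover have "\<forall>i\<in>{1..card C}. a (h i) \<in> topological_dual"
    using assms(2) img by blast
  ultimately show ?thesis
    unfolding polyhedral_convex_def
    by (intro exI[of _ "card C"] exI[of _ "\<lambda>i. a (h i)"] exI[of _ "\<lambda>i. \<gamma> (h i)"]) simp
qed

lemma topological_dual_linear: "f \<in> topological_dual \<Longrightarrow> linear f"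
  by (simp add: topological_dual_def)

lemma topological_dual_zero: "(\<lambda>_. 0) \<in> topological_dual"
  by (simp add: topological_dual_def linear_iff)

lemma linear_combination_of_functionals:
  fixes f g :: "'v::real_vector \<Rightarrow> real"
  assumes "linear f" "linear g"
  shows "linear (\<lambda>x. s * f x - t * g x)"
  using assms by (simp add: linear_iff algebra_simps)

lemma topological_dual_combination:
  assumes "f \<in> topological_dual" "g \<in> topological_dual"
  shows "(\<lambda>x. s * f x - t * g x) \<in> topological_dual"
  using assms unfolding topological_dual_def
  by (auto intro!: linear_combination_of_functionals continuous_intros)

lemma topological_dual_fst_slice:
  fixes f :: "'x::locally_convex_hausdorff \<times> 'y::locally_convex_hausdorff \<Rightarrow> real"
  assumes "f \<in> topological_dual"
  shows "(\<lambda>x. f (x, 0)) \<in> topological_dual"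
proof -
  have lin: "linear f" and cont: "continuous_on UNIV f"
    using assms by (auto simp: topological_dual_def)
  have "linear (\<lambda>x::'x. (x, 0::'y))"
    by (simp add: linear_iff)
  from linear_compose[OF this lin] have "linear (\<lambda>x. f (x, 0))"
    by (simp add: o_def)
  moreover have "continuous_on UNIV (\<lambda>x. f (x, 0))"
    by (rule continuous_on_compose2[OF cont]) (auto intro!: continuous_intros)
  ultimately show ?thesis
    by (simp add: topological_dual_def)
qed

lemma linear_snd_slice:
  fixes f :: "'x::real_vector \<times> 'y::real_vector \<Rightarrow> real"
  assumes "linear f"
  shows "linear (\<lambda>y. f (0, y))"
proof -
  have "linear (\<lambda>y::'y. (0::'x, y))"
    by (simp add: linear_iff)
  from linear_compose[OF this assms] show ?thesis
    by (simp add: o_def)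
qed

section \<open>Fourier-Motzkin elimination\<close>

text \<open>
  Each inequality with \<open>d c > 0\<close> bounds \<open>s\<close> from above by \<open>u c / d c\<close>, each one with
  \<open>d c < 0\<close> bounds it from below by the same quotient. A suitable \<open>s\<close> exists once every
  lower bound is at most every upper bound: the largest lower bound, or the smallest upper
  bound if there are no lower ones, will do.
\<close>

lemma one_variable_elimination:
  fixes d u :: "'c \<Rightarrow> real"
  assumes "finite C"
  shows "(\<exists>s. \<forall>c\<in>C. s * d c \<le> u c) \<longleftrightarrow>
    (\<forall>c\<in>C. d c = 0 \<longrightarrow> 0 \<le> u c) \<and>
    (\<forall>p\<in>C. \<forall>q\<in>C. d p > 0 \<longrightarrow> d q < 0 \<longrightarrow> d q * u p \<le> d p * u q)"
    (is "?solvable \<longleftrightarrow> ?zero \<and> ?pairs")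
proof
  assume ?solvable
  then obtain s where s: "\<And>c. c \<in> C \<Longrightarrow> s * d c \<le> u c"
    by blast
  have ?zero
    using s by force
  moreover have "d q * u p \<le> d p * u q" if "p \<in> C" "q \<in> C" "d p > 0" "d q < 0" for p q
  proof -
    have "d q * u p \<le> d q * (s * d p)"
      using s[OF that(1)] that(4) by (simp add: mult_left_mono_neg)
    also have "\<dots> = d p * (s * d q)"
      by simp
    also have "\<dots> \<le> d p * u q"
      using s[OF that(2)] that(3) by simp
    finally show ?thesis .
  qed
  ultimately show "?zero \<and> ?pairs"
    by blast
next
  assume R: "?zero \<and> ?pairs"
  define lower where "lower = (\<lambda>q. u q / d q) ` {q\<in>C. d q < 0}"
  define upper where "upper = (\<lambda>p. u p / d p) ` {p\<in>C. d p > 0}"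
  have fin: "finite lower" "finite upper"
    using assms by (auto simp: lower_def upper_def)
  have between: "l \<le> r" if "l \<in> lower" "r \<in> upper" for l r
    using that R by (auto simp: lower_def upper_def divide_simps mult.commute)
  obtain s where lo: "\<And>l. l \<in> lower \<Longrightarrow> l \<le> s" and up: "\<And>r. r \<in> upper \<Longrightarrow> s \<le> r"
  proof (cases "lower = {}")
    case False
    show ?thesis
      by (rule that[of "Max lower"]) (use False fin between in auto)
  next
    case True
    show ?thesis
    proof (cases "upper = {}")
      case False
      show ?thesis
        by (rule that[of "Min upper"]) (use True False fin in auto)
    qed (use True that in auto)
  qed
  have "s * d c \<le> u c" if c: "c \<in> C" for c
  proof -
    consider "d c = 0" | "d c > 0" | "d c < 0"
      by linarith
    then show ?thesis
    proof cases
      case 1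
      then show ?thesis using R c by auto
    next
      case 2
      then have "s \<le> u c / d c"
        using up c by (auto simp: upper_def)
      then show ?thesis using 2 by (simp add: pos_le_divide_eq)
    next
      case 3
      then have "u c / d c \<le> s"
        using lo c by (auto simp: lower_def)
      then show ?thesis using 3 by (simp add: neg_divide_le_eq)
    qed
  qed
  then show ?solvable
    by blast
qed

lemma subspace_split_along:
  fixes e :: "'v::real_vector \<Rightarrow> real"
  assumes V: "subspace V" and e: "linear e" and v: "v \<in> V" "e v \<noteq> 0"
  shows "(\<exists>y\<in>V. P y) \<longleftrightarrow> (\<exists>w\<in>V \<inter> {w. e w = 0}. \<exists>s. P (w + s *\<^sub>R v))"
proof
  assume "\<exists>y\<in>V. P y"
  then obtain y where y: "y \<in> V" "P y"
    by blast
  define s where "s = e y / e v"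
  have "y - s *\<^sub>R v \<in> V"
    using V v y by (simp add: subspace_diff subspace_scale)
  moreover have "e (y - s *\<^sub>R v) = 0"
    using v by (simp add: s_def linear_diff[OF e] linear_scale[OF e])
  moreover have "P (y - s *\<^sub>R v + s *\<^sub>R v)"
    using y by simp
  ultimately show "\<exists>w\<in>V \<inter> {w. e w = 0}. \<exists>s. P (w + s *\<^sub>R v)"
    by blast
next
  assume "\<exists>w\<in>V \<inter> {w. e w = 0}. \<exists>s. P (w + s *\<^sub>R v)"
  then show "\<exists>y\<in>V. P y"
    using V v by (blast intro: subspace_add subspace_scale)
qed

text \<open>
  A triple \<open>(a, b, \<gamma>)\<close> stands for the inequality \<open>a x + b y \<le> \<gamma>\<close>. An elimination step
  can increase the number of inequalities, so that number cannot serve as induction measure.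
  The induction runs instead over a separate set \<open>E\<close> of functionals, whose common kernel in
  \<open>V\<close> is annihilated by all \<open>b\<close>; this property survives both the passage to linear
  combinations of the \<open>b\<close> and the removal of a functional from \<open>E\<close> together with the
  restriction of \<open>V\<close> to its kernel.
\<close>

lemma polyhedral_convex_projection_aux:
  fixes C :: "(('x::locally_convex_hausdorff \<Rightarrow> real) \<times> ('v::real_vector \<Rightarrow> real) \<times> real) set"
    and E :: "('v \<Rightarrow> real) set"
  assumes "finite E" and "\<And>e. e \<in> E \<Longrightarrow> linear e"
    and "subspace V" and "finite C"
    and "\<And>a b \<gamma>. (a, b, \<gamma>) \<in> C \<Longrightarrow> a \<in> topological_dual \<and> linear b"
    and "\<And>a b \<gamma> y. (a, b, \<gamma>) \<in> C \<Longrightarrow> y \<in> V \<Longrightarrow> (\<forall>e\<in>E. e y = 0) \<Longrightarrow> b y = 0"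
  shows "polyhedral_convex {x. \<exists>y\<in>V. \<forall>(a, b, \<gamma>)\<in>C. a x + b y \<le> \<gamma>}"
  using assms
proof (induction E arbitrary: V C rule: finite_induct)
  case empty
  have vanish: "fst (snd c) y = 0" if "c \<in> C" "y \<in> V" for c y
    using empty.prems(5)[of "fst c" "fst (snd c)" "snd (snd c)" y] that by simp
  have "0 \<in> V"
    using empty.prems(2) by (rule subspace_0)
  have "(\<forall>(a, b, \<gamma>)\<in>C. a x + b y \<le> \<gamma>) \<longleftrightarrow> (\<forall>c\<in>C. fst c x \<le> snd (snd c))" if "y \<in> V" for x y
    by (rule ball_cong[OF refl]) (simp add: vanish that case_prod_unfold)
  with \<open>0 \<in> V\<close> have "{x. \<exists>y\<in>V. \<forall>(a, b, \<gamma>)\<in>C. a x + b y \<le> \<gamma>} =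
      {x. \<forall>c\<in>C. fst c x \<le> snd (snd c)}"
    by blast
  also have "polyhedral_convex \<dots>"
    using empty.prems(3,4) by (intro polyhedral_convex_finite_system) auto
  finally show ?case .
next
  case (insert e E)
  have lin_e: "linear e"
    using insert.prems(1) by simp
  show ?case
  proof (cases "\<forall>v\<in>V. e v = 0")
    case True
    show ?thesis
      by (rule insert.IH)
        (use True insert.prems(1-4) insert.prems(5) in auto)
  next
    case False
    then obtain v where v: "v \<in> V" "e v \<noteq> 0"
      by blast
    define W where "W = V \<inter> {w. e w = 0}"
    define slope where "slope c = fst (snd c) v"
      for c :: "('x \<Rightarrow> real) \<times> ('v \<Rightarrow> real) \<times> real"
    define slack where "slack c x w = snd (snd c) - (fst c x + fst (snd c) w)"
      for c :: "('x \<Rightarrow> real) \<times> ('v \<Rightarrow> real) \<times> real" and x w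
    \<comment> \<open>For a positive slope of \<open>p\<close> and a negative slope of \<open>q\<close> this is the combination
      of the two inequalities with positive weights in which \<open>v\<close> cancels.\<close>
    define cancel where "cancel = (\<lambda>(p, q).
       (\<lambda>x. slope p * fst q x - slope q * fst p x,
        \<lambda>w. slope p * fst (snd q) w - slope q * fst (snd p) w,
        slope p * snd (snd q) - slope q * snd (snd p)))"
    define C' where "C' = {c\<in>C. slope c = 0} \<union>
       cancel ` ({p\<in>C. slope p > 0} \<times> {q\<in>C. slope q < 0})"
    have C: "fst c \<in> topological_dual" "linear (fst (snd c))" if "c \<in> C" for c
      using insert.prems(4) that by (cases c; auto)+
    have vanish: "fst (snd c) y = 0" if "c \<in> C" "y \<in> W" "\<forall>e\<in>E. e y = 0" for c y
      using insert.prems(5)[of "fst c" "fst (snd c)" "snd (snd c)" y] that by (auto simp: W_def)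
    have step: "(\<exists>y\<in>V. \<forall>(a, b, \<gamma>)\<in>C. a x + b y \<le> \<gamma>) \<longleftrightarrow>
                (\<exists>w\<in>W. \<forall>(a, b, \<gamma>)\<in>C'. a x + b w \<le> \<gamma>)" for x
    proof -
      have "(\<exists>y\<in>V. \<forall>(a, b, \<gamma>)\<in>C. a x + b y \<le> \<gamma>) \<longleftrightarrow>
            (\<exists>w\<in>W. \<exists>s. \<forall>(a, b, \<gamma>)\<in>C. a x + b (w + s *\<^sub>R v) \<le> \<gamma>)"
        unfolding W_def by (rule subspace_split_along[OF insert.prems(2) lin_e v])
      also have "\<dots> \<longleftrightarrow> (\<exists>w\<in>W. \<exists>s. \<forall>c\<in>C. s * slope c \<le> slack c x w)"
      proof -
        have "(case c of (a, b, \<gamma>) \<Rightarrow> a x + b (w + s *\<^sub>R v) \<le> \<gamma>) \<longleftrightarrow>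
              s * slope c \<le> slack c x w" if "c \<in> C" for c w s
          using C(2)[OF that]
          by (auto simp: slope_def slack_def linear_add linear_scale split: prod.splits)
        then show ?thesis
          by simp
      qed
      also have "\<dots> \<longleftrightarrow> (\<exists>w\<in>W. (\<forall>c\<in>C. slope c = 0 \<longrightarrow> 0 \<le> slack c x w) \<and>
          (\<forall>p\<in>C. \<forall>q\<in>C. slope p > 0 \<longrightarrow> slope q < 0 \<longrightarrow>
             slope q * slack p x w \<le> slope p * slack q x w))"
        by (simp add: one_variable_elimination[OF insert.prems(3)])
      also have "\<dots> \<longleftrightarrow> (\<exists>w\<in>W. \<forall>c\<in>C'. 0 \<le> slack c x w)"
      proof -
        have "slope q * slack p x w \<le> slope p * slack q x w \<longleftrightarrow> 0 \<le> slack (cancel (p, q)) x w"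
          for p q w
          by (simp add: cancel_def slack_def algebra_simps)
        then show ?thesis
          unfolding C'_def by (intro bex_cong refl) blast
      qed
      also have "\<dots> \<longleftrightarrow> (\<exists>w\<in>W. \<forall>(a, b, \<gamma>)\<in>C'. a x + b w \<le> \<gamma>)"
        by (simp add: slack_def case_prod_unfold)
      finally show ?thesis .
    qed
    have C': "fst c \<in> topological_dual \<and> linear (fst (snd c)) \<and>
        (\<forall>y\<in>W. (\<forall>e\<in>E. e y = 0) \<longrightarrow> fst (snd c) y = 0)" if "c \<in> C'" for c
    proof -
      from that consider "c \<in> C" | p q where "p \<in> C" "q \<in> C" "c = cancel (p, q)"
        unfolding C'_def by blast
      then show ?thesis
        by cases (simp_all add: C vanish cancel_def topological_dual_combination
            linear_combination_of_functionals)
    qed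
    have "polyhedral_convex {x. \<exists>w\<in>W. \<forall>(a, b, \<gamma>)\<in>C'. a x + b w \<le> \<gamma>}"
    proof (rule insert.IH)
      show "subspace W"
        unfolding W_def using insert.prems(2) linear_subspace_kernel[OF lin_e]
        by (rule subspace_inter)
      show "finite C'"
        using insert.prems(3) by (simp add: C'_def)
    qed (use insert.prems(1) C' in \<open>fastforce+\<close>)
    then show ?thesis
      by (simp add: step)
  qed
qed

text \<open>The functionals \<open>b\<close> of the system themselves may serve as the set \<open>E\<close>.\<close>

lemma polyhedral_convex_projection:
  fixes C :: "(('x::locally_convex_hausdorff \<Rightarrow> real) \<times> ('v::real_vector \<Rightarrow> real) \<times> real) set"
  assumes "subspace V" and "finite C"
    and "\<And>a b \<gamma>. (a, b, \<gamma>) \<in> C \<Longrightarrow> a \<in> topological_dual \<and> linear b"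
  shows "polyhedral_convex {x. \<exists>y\<in>V. \<forall>(a, b, \<gamma>)\<in>C. a x + b y \<le> \<gamma>}"
  by (rule polyhedral_convex_projection_aux[where E = "(\<lambda>c. fst (snd c)) ` C"])
    (use assms in force)+

section \<open>Inverse images under polyhedral convex multifunctions\<close>

lemma polyhedral_convex_multi_inverse_image:
  fixes F :: "'x::locally_convex_hausdorff \<Rightarrow> 'y::locally_convex_hausdorff set"
  assumes "polyhedral_convex_multifunction F" and "generalized_polyhedral_convex D"
  shows "polyhedral_convex (multi_inverse_image F D)"
proof -
  obtain m :: nat and f \<alpha> where f: "\<And>i. i \<in> {1..m} \<Longrightarrow> f i \<in> topological_dual"
      and "gph F = {z. \<forall>i\<in>{1..m}. f i z \<le> \<alpha> i}"
    using assms(1) unfolding polyhedral_convex_multifunction_def polyhedral_convex_def by blast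
  then have F: "y \<in> F x \<longleftrightarrow> (\<forall>i\<in>{1..m}. f i (x, y) \<le> \<alpha> i)" for x y
    unfolding gph_def by blast
  obtain n :: nat and g \<beta> L where g: "\<And>j. j \<in> {1..n} \<Longrightarrow> g j \<in> topological_dual"
      and L: "affine L" and D: "D = {y. y \<in> L \<and> (\<forall>j\<in>{1..n}. g j y \<le> \<beta> j)}"
    using assms(2) unfolding generalized_polyhedral_convex_def by blast
  show ?thesis
  proof (cases "L = {}")
    case True
    then show ?thesis
      by (simp add: D multi_inverse_image_def polyhedral_convex_empty)
  next
    case False
    then obtain y0 where y0: "y0 \<in> L"
      by blast
    define V where "V = (\<lambda>y. y - y0) ` L"
    have V: "subspace V"
      unfolding V_def using affine_diffs_subspace_subtract[OF L y0] by (simp add: image_def)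
    define C where "C =
       (\<lambda>i. (\<lambda>x. f i (x, 0), \<lambda>y. f i (0, y), \<alpha> i - f i (0, y0))) ` {1..m} \<union>
       (\<lambda>j. (\<lambda>x. 0, g j, \<beta> j - g j y0)) ` {1..n}"
    have linear_f: "linear (\<lambda>y. f i (0, y))" if "i \<in> {1..m}" for i
      by (rule linear_snd_slice[OF topological_dual_linear[OF f[OF that]]])
    have split_f: "f i (x, y) = f i (x, 0) + f i (0, y - y0) + f i (0, y0)"
      if "i \<in> {1..m}" for i x y
      using linear_add[OF topological_dual_linear[OF f[OF that]], of "(x, 0)" "(0, y)"]
        linear_diff[OF linear_f[OF that], of y y0]
      by simp
    have split_g: "g j y = g j (y - y0) + g j y0" if "j \<in> {1..n}" for j y
      using linear_diff[OF topological_dual_linear[OF g[OF that]], of y y0] by simp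
    have iff: "y \<in> F x \<and> (\<forall>j\<in>{1..n}. g j y \<le> \<beta> j) \<longleftrightarrow>
        (\<forall>(a, b, \<gamma>)\<in>C. a x + b (y - y0) \<le> \<gamma>)" for x y
    proof -
      have "f i (x, y) \<le> \<alpha> i \<longleftrightarrow> f i (x, 0) + f i (0, y - y0) \<le> \<alpha> i - f i (0, y0)"
        if "i \<in> {1..m}" for i
        using split_f[OF that, of x y] by linarith
      moreover have "g j y \<le> \<beta> j \<longleftrightarrow> 0 + g j (y - y0) \<le> \<beta> j - g j y0"
        if "j \<in> {1..n}" for j
        using split_g[OF that, of y] by linarith
      ultimately show ?thesis
        unfolding F C_def ball_Un ball_simps prod.case by simp
    qed
    have "multi_inverse_image F D = {x. \<exists>y\<in>V. \<forall>(a, b, \<gamma>)\<in>C. a x + b y \<le> \<gamma>}"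
      unfolding multi_inverse_image_eq V_def bex_simps iff[symmetric] D by blast
    also have "polyhedral_convex \<dots>"
    proof (rule polyhedral_convex_projection[OF V])
      show "finite C"
        by (simp add: C_def)
      show "a \<in> topological_dual \<and> linear b" if "(a, b, \<gamma>) \<in> C" for a b \<gamma>
        using that f g linear_f unfolding C_def
        by (auto intro: topological_dual_fst_slice topological_dual_zero topological_dual_linear)
    qed
    finally show ?thesis .
  qed
qed

theorem corollary3p9:
  fixes F :: "'x::locally_convex_hausdorff \<Rightarrow> 'y::locally_convex_hausdorff set"
  assumes "polyhedral_convex_multifunction F"
  shows "(\<forall>D. generalized_polyhedral_convex D \<longrightarrow> polyhedral_convex (multi_inverse_image F D)) \<and>
         (\<forall>Q. polyhedral_convex Q \<longrightarrow> polyhedral_convex (multi_inverse_image F Q))"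
  using polyhedral_convex_multi_inverse_image[OF assms] polyhedral_convex_imp_generalized
  by blast

end
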